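(* Let $V$ be a vertex algebra over $\mathbf{k}$ (an algebraically closed field of characteristic $0$). Then the set of equivalence classes of first order deformations of $V$ corresponds bijectively to the second cohomology $H^2(V,V)$ of $V$ with coefficients in $V$ regarded as a module over itself.
   Context: All vector spaces, linear maps and tensor products are over an algebraically closed field $\mathbf{k}$ of characteristic $0$. For $n\in\mathbb{Z}$, $(x+y)^n:=\sum_{k\ge 0}\binom{n}{k}x^{n-k}y^k$ (expansion in nonnegative powers of the second variable); an expression with a subscript $x+z$ is the corresponding series with the variable replaced by $x+z$ and expanded by this convention. No grading is assumed anywhere. Vertex algebra: a quadruple $(V,{}_{\dot z},\mathbf{1},d)$ with $V$ a vector space, a linear map $V\otimes V\to V((z))$, $a\otimes b\mapsto a\,{}_{\dot z}\,b$ (usually written $Y(a,z)b$), a vector $\mathbf{1}\in V$ and $d\in\mathrm{End}(V)$ such that for all $a,b,c\in V$: - Unit: $\mathbf{1}\,{}_{\dot z}\,a=a$ and $a\,{}_{\dot z}\,\mathbf{1}=e^{zd}a$. - Translation-derivation: $(da)\,{}_{\dot z}\,b=\frac{d}{dz}(a\,{}_{\dot z}\,b)$ and $d(a\,{}_{\dot z}\,b)=(da)\,{}_{\dot z}\,b+a\,{}_{\dot z}\,(db)$. - Commutativity: $a\,{}_{\dot z}\,b=e^{zd}(b\,{}_{\dot{-z}}\,a)$. - Associativity: there exists $l\in\mathbb{N}$ (depending on $a,b,c$) with $(z+w)^l(a\,{}_{\dot z}\,b)\,{}_{\dot w}\,c=(z+w)^l\,a\,{}_{\dot{z+w}}\,(b\,{}_{\dot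 w}\,c)$. Cohomology with coefficients in $V$: - $C^1(V,V)=\{g\in\mathrm{End}_{\mathbf{k}}(V): g(da)=d\,g(a)\text{ for all }a\in V,\ g(\mathbf{1})=0\}$. - For $g\in C^1(V,V)$, $(\delta_1 g)_z(a,b)=a\,{}_{\dot z}\,g(b)-g(a\,{}_{\dot z}\,b)+g(a)\,{}_{\dot z}\,b$. - $C^2(V,V)$ is the space of linear maps $f_z:V\otimes V\to V((z))$ such that for all $a,b\in V$: $f_z(a,\mathbf{1})=f_z(\mathbf{1},b)=0$; $\frac{d}{dz}f_z(a,b)=f_z(da,b)$; $d(f_z(a,b))=f_z(da,b)+f_z(a,db)$; $f_z(a,b)=e^{zd}f_{-z}(b,a)$. - $Z^2(V,V)$ is the space of $f_z\in C^2(V,V)$ such that for all $a,b,c\in V$ there is $n\in\mathbb{N}$ with $$(x+z)^n\big[f_z(a\,{}_{\dot x}\,b,c)+f_x(a,b)\,{}_{\dot z}\,c\big]=(x+z)^n\big[a\,{}_{\dot{x+z}}\,f_z(b,c)+f_{x+z}(a,b\,{}_{\dot z}\,c)\big].$$ - $H^2(V,V)=Z^2(V,V)/\mathrm{Im}\,\delta_1$ (one has $\mathrm{Im}\,\delta_1\subseteq Z^2(V,V)$). First order deformations: Let $t$ be a formal variable. A first order deformation of $(V,{}_{\dot z},\mathbf{1},d)$ is a family of products of the form $a\ast_z b=a\,{}_{\dot z}\,b+t\,f_z(a,b)$ for $a,b\in V$, where $f_z:V\otimes V\to V((z))$ is a linear map independent of $t$, such that (extending everything linearly in $t$) for all $a,b,c\in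 V$: - $\mathbf{1}\ast_z a=a$ and $a\ast_z\mathbf{1}=e^{zd}a$; - $(da)\ast_z b=\frac{d}{dz}(a\ast_z b)$ and $d(a\ast_z b)=(da)\ast_z b+a\ast_z(db)$; - $a\ast_z b=e^{zd}(b\ast_{-z}a)$; - there exists $l\in\mathbb{N}$ with $(z+w)^l(a\ast_z b)\ast_w c=(z+w)^l\,a\ast_{z+w}(b\ast_w c)\pmod{t^2}$. Two first order deformations $\ast^{(1)}_z$ and $\ast^{(2)}_z$ of $V$ are equivalent if there exists a family $\phi_t:V\to V[t]$ of linear maps of the form $\phi_t=1_V+t\,g$, with $g:V\to V$ a linear map, such that $\phi_t(a\ast^{(1)}_z b)=\phi_t(a)\ast^{(2)}_z\phi_t(b)\pmod{t^2}$ for all $a,b\in V$. *)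

theory Defs
  imports
    "HOL-Computational_Algebra.Computational_Algebra"
    "HOL-Library.Groups_Big_Fun"
begin

unbundle fps_syntax

section \<open>Laurent series with coefficients in a vector space\<close>

text \<open>
  \<open>V((z))\<close> is the type \<open>'v fls\<close>. The library operations on \<open>fls\<close> beyond addition presuppose a
  ring of coefficients, so the ones needed for vector coefficients are introduced here,
  parametrised by the scalar multiplication \<open>s\<close>. They are total functions by way of
  \<open>Abs_fls\<close>; the lemmas show that they have the intended coefficients.
\<close>

definition fls_map :: "('v::zero \<Rightarrow> 'w::zero) \<Rightarrow> 'v fls \<Rightarrow> 'w fls"
  where "fls_map h F = Abs_fls (\<lambda>n. h (F $$ n))"

definition fls_ddz :: "('k::ring_1 \<Rightarrow> 'v \<Rightarrow> 'v) \<Rightarrow> 'v::zero fls \<Rightarrow> 'v fls"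
  where "fls_ddz s F = Abs_fls (\<lambda>n. s (of_int (n + 1)) (F $$ (n + 1)))"

text \<open>The substitution \<open>z \<mapsto> -z\<close>.\<close>

definition fls_reflect :: "'v::ab_group_add fls \<Rightarrow> 'v fls"
  where "fls_reflect F = Abs_fls (\<lambda>n. if even n then F $$ n else - (F $$ n))"

text \<open>
  \<open>e\<^sup>z\<^sup>d F(z)\<close>. The sum is over all natural numbers \<open>k\<close> and has finite support, because \<open>F\<close> has
  only finitely many coefficients of negative degree.
\<close>

definition fls_exp ::
    "('k::field_char_0 \<Rightarrow> 'v \<Rightarrow> 'v) \<Rightarrow> ('v \<Rightarrow> 'v) \<Rightarrow> 'v::ab_group_add fls \<Rightarrow> 'v fls"
  where "fls_exp s d F =
    Abs_fls (\<lambda>n. \<Sum>k::nat. s (inverse (fact k)) ((d ^^ k) (F $$ (n - int k))))"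

lemma fls_map_nth [simp]: "h 0 = 0 \<Longrightarrow> fls_map h F $$ n = h (F $$ n)"
  unfolding fls_map_def
  by (rule nth_Abs_fls_lower_bound[of "fls_subdegree F"]) simp

lemma fls_ddz_nth:
  "(\<And>c. s c 0 = 0) \<Longrightarrow> fls_ddz s F $$ n = s (of_int (n + 1)) (F $$ (n + 1))"
  unfolding fls_ddz_def
  by (rule nth_Abs_fls_lower_bound[of "fls_subdegree F - 1"]) simp

lemma fls_reflect_nth: "fls_reflect F $$ n = (if even n then F $$ n else - (F $$ n))"
  unfolding fls_reflect_def
  by (rule nth_Abs_fls_lower_bound[of "fls_subdegree F"]) simp

lemma
  fixes s :: "'k::field_char_0 \<Rightarrow> 'v \<Rightarrow> 'v::ab_group_add"
  assumes "\<And>c. s c 0 = 0" and "d 0 = 0"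
  shows fls_exp_nth: "fls_exp s d F $$ n =
      (\<Sum>k::nat. s (inverse (fact k)) ((d ^^ k) (F $$ (n - int k))))"
    and fls_exp_finite: "finite {k. s (inverse (fact k)) ((d ^^ k) (F $$ (n - int k))) \<noteq> 0}"
proof -
  have d0: "(d ^^ k) 0 = 0" for k
    by (induction k) (simp_all add: assms)
  show "fls_exp s d F $$ n = (\<Sum>k::nat. s (inverse (fact k)) ((d ^^ k) (F $$ (n - int k))))"
    unfolding fls_exp_def
    by (rule nth_Abs_fls_lower_bound[of "fls_subdegree F"]) (simp add: assms d0)
  have "{k. s (inverse (fact k)) ((d ^^ k) (F $$ (n - int k))) \<noteq> 0}
      \<subseteq> {..nat (n - fls_subdegree F)}"
  proof
    fix k assume "k \<in> {k. s (inverse (fact k)) ((d ^^ k) (F $$ (n - int k))) \<noteq> 0}"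
    then have "\<not> n - int k < fls_subdegree F"
      by (auto simp: assms d0)
    then show "k \<in> {..nat (n - fls_subdegree F)}" by simp
  qed
  then show "finite {k. s (inverse (fact k)) ((d ^^ k) (F $$ (n - int k))) \<noteq> 0}"
    by (rule finite_subset) simp
qed


section \<open>Iterated products in two formal variables\<close>

text \<open>
  A formal series \<open>G\<close> in \<open>x\<close>, \<open>z\<close> is the function sending \<open>p\<close>, \<open>q\<close> to the coefficient of
  \<open>x\<^sup>p z\<^sup>q\<close>. For products \<open>P\<close>, \<open>Q\<close>, writing \<open>P\<^sub>z(a,b)\<close> for \<open>P a b\<close>:

  \<^item> \<open>iter_left P Q a b c\<close> is \<open>Q\<^sub>z(P\<^sub>x(a,b), c)\<close>;
  \<^item> \<open>iter_right s P Q a b c\<close> is \<open>P\<^sub>x\<^sub>+\<^sub>z(a, Q\<^sub>z(b,c))\<close>, where \<open>(x+z)\<^sup>n\<close> is expanded in nonnegative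
    powers of \<open>z\<close>. A monomial \<open>y\<^sup>n z\<^sup>m\<close> of \<open>P\<^sub>y(a, Q\<^sub>z(b,c))\<close> becomes the sum over \<open>k\<close> of
    \<open>(n choose k) x\<^sup>n\<^sup>-\<^sup>k z\<^sup>m\<^sup>+\<^sup>k\<close>, and hence contributes to \<open>x\<^sup>p z\<^sup>q\<close> for \<open>n = p + k\<close>, \<open>m = q - k\<close>; the sum over
    \<open>k\<close> is finite since \<open>Q b c\<close> is a Laurent series;
  \<^item> \<open>binomial_mult s l G\<close> is \<open>(x+z)\<^sup>l G\<close>.
\<close>

definition iter_left ::
    "('u \<Rightarrow> 'v \<Rightarrow> 'w::zero fls) \<Rightarrow> ('w \<Rightarrow> 'v \<Rightarrow> 'y::zero fls) \<Rightarrow> 'u \<Rightarrow> 'v \<Rightarrow> 'v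
      \<Rightarrow> int \<Rightarrow> int \<Rightarrow> 'y"
  where "iter_left P Q a b c = (\<lambda>p q. Q (P a b $$ p) c $$ q)"

definition iter_right ::
    "('k::field_char_0 \<Rightarrow> 'y \<Rightarrow> 'y) \<Rightarrow> ('u \<Rightarrow> 'w \<Rightarrow> 'y::ab_group_add fls)
      \<Rightarrow> ('u \<Rightarrow> 'u \<Rightarrow> 'w::zero fls) \<Rightarrow> 'u \<Rightarrow> 'u \<Rightarrow> 'u \<Rightarrow> int \<Rightarrow> int \<Rightarrow> 'y"
  where "iter_right s P Q a b c =
    (\<lambda>p q. \<Sum>k::nat. s (of_int (p + int k) gchoose k) (P a (Q b c $$ (q - int k)) $$ (p + int k)))"

definition binomial_mult ::
    "('k::field_char_0 \<Rightarrow> 'y \<Rightarrow> 'y) \<Rightarrow> nat \<Rightarrow> (int \<Rightarrow> int \<Rightarrow> 'y::ab_group_add) \<Rightarrow> int \<Rightarrow> int \<Rightarrow> 'y"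
  where "binomial_mult s l G =
    (\<lambda>p q. \<Sum>i\<le>l. s (of_nat (l choose i)) (G (p - int (l - i)) (q - int i)))"

text \<open>Linear maps \<open>V \<otimes> V \<rightarrow> V((z))\<close>, as bilinear maps; linearity is checked on each coefficient.\<close>

definition bilinear_fls ::
    "('k::field \<Rightarrow> 'v \<Rightarrow> 'v) \<Rightarrow> ('v \<Rightarrow> 'v \<Rightarrow> 'v::ab_group_add fls) \<Rightarrow> bool"
  where "bilinear_fls s P \<longleftrightarrow>
    (\<forall>b n. Vector_Spaces.linear s s (\<lambda>a. P a b $$ n)) \<and>
    (\<forall>a n. Vector_Spaces.linear s s (\<lambda>b. P a b $$ n))"


section \<open>Vertex algebras and their second cohomology\<close>

locale vertex_algebra = vector_space scale
  for scale :: "'k::{alg_closed_field, field_char_0} \<Rightarrow> 'v::ab_group_add \<Rightarrow> 'v" +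
  fixes Y :: "'v \<Rightarrow> 'v \<Rightarrow> 'v fls"
    and vac :: 'v
    and d :: "'v \<Rightarrow> 'v"
  assumes bilinear_Y: "bilinear_fls scale Y"
    and linear_d: "Vector_Spaces.linear scale scale d"
    and unit_left: "Y vac a = fls_const a"
    and unit_right: "Y a vac = fls_exp scale d (fls_const a)"
    and translation: "Y (d a) b = fls_ddz scale (Y a b)"
    and derivation: "fls_map d (Y a b) = Y (d a) b + Y a (d b)"
    and commutativity: "Y a b = fls_exp scale d (fls_reflect (Y b a))"
    and associativity:
      "\<exists>l. binomial_mult scale l (iter_left Y Y a b c)
         = binomial_mult scale l (iter_right scale Y Y a b c)"
begin

definition C1 :: "('v \<Rightarrow> 'v) set"
  where "C1 = {g. Vector_Spaces.linear scale scale g \<and> (\<forall>a. g (d a) = d (g a)) \<and> g vac = 0}"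

definition \<delta>1 :: "('v \<Rightarrow> 'v) \<Rightarrow> 'v \<Rightarrow> 'v \<Rightarrow> 'v fls"
  where "\<delta>1 g = (\<lambda>a b. Y a (g b) - fls_map g (Y a b) + Y (g a) b)"

definition C2 :: "('v \<Rightarrow> 'v \<Rightarrow> 'v fls) set"
  where "C2 = {f. bilinear_fls scale f \<and>
    (\<forall>a. f a vac = 0) \<and> (\<forall>b. f vac b = 0) \<and>
    (\<forall>a b. fls_ddz scale (f a b) = f (d a) b) \<and>
    (\<forall>a b. fls_map d (f a b) = f (d a) b + f a (d b)) \<and>
    (\<forall>a b. f a b = fls_exp scale d (fls_reflect (f b a)))}"

definition Z2 :: "('v \<Rightarrow> 'v \<Rightarrow> 'v fls) set"
  where "Z2 = {f \<in> C2. \<forall>a b c. \<exists>n.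
    binomial_mult scale n
      (\<lambda>p q. iter_left Y f a b c p q + iter_left f Y a b c p q) =
    binomial_mult scale n
      (\<lambda>p q. iter_right scale Y f a b c p q + iter_right scale f Y a b c p q)}"

definition cohomologous :: "(('v \<Rightarrow> 'v \<Rightarrow> 'v fls) \<times> ('v \<Rightarrow> 'v \<Rightarrow> 'v fls)) set"
  where "cohomologous = {(f, f'). f \<in> Z2 \<and> f' \<in> Z2 \<and> (\<lambda>a b. f a b - f' a b) \<in> \<delta>1 ` C1}"

definition H2 :: "('v \<Rightarrow> 'v \<Rightarrow> 'v fls) set set"
  where "H2 = Z2 // cohomologous"

end


section \<open>First order deformations\<close>

text \<open>
  \<open>V[t]\<close> is the type \<open>'v poly\<close>, with scalar multiplication and the operator \<open>d\<close> extended
  coefficientwise by \<^const>\<open>map_poly\<close>. A vector \<open>a\<close> is identified with \<open>[:a:]\<close>, and multiplication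
  by \<open>t\<close> is \<open>pCons 0\<close>. The following are the extensions of maps on \<open>V\<close> with values in \<open>V[t]\<close>
  to maps on \<open>V[t]\<close> that are linear in \<open>t\<close>.
\<close>

definition t_extend :: "('v::ab_group_add \<Rightarrow> 'v poly) \<Rightarrow> 'v poly \<Rightarrow> 'v poly"
  where "t_extend h p = (\<Sum>i\<le>degree p. (pCons 0 ^^ i) (h (coeff p i)))"

definition t_extend2 ::
    "('v::ab_group_add \<Rightarrow> 'v \<Rightarrow> 'v poly fls) \<Rightarrow> 'v poly \<Rightarrow> 'v poly \<Rightarrow> 'v poly fls"
  where "t_extend2 P p q =
    (\<Sum>i\<le>degree p. \<Sum>j\<le>degree q. fls_map (pCons 0 ^^ (i + j)) (P (coeff p i) (coeff q j)))"

definition cong_t2 :: "'v::zero poly \<Rightarrow> 'v poly \<Rightarrow> bool"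
  where "cong_t2 p q \<longleftrightarrow> (\<forall>i<2. coeff p i = coeff q i)"

context vertex_algebra
begin

abbreviation scale_t :: "'k \<Rightarrow> 'v poly \<Rightarrow> 'v poly"
  where "scale_t c \<equiv> map_poly (scale c)"

abbreviation d_t :: "'v poly \<Rightarrow> 'v poly"
  where "d_t \<equiv> map_poly d"

text \<open>The product \<open>a \<ast>\<^sub>z b = Y(a,z) b + t f\<^sub>z(a,b)\<close>.\<close>

definition deformed :: "('v \<Rightarrow> 'v \<Rightarrow> 'v fls) \<Rightarrow> 'v \<Rightarrow> 'v \<Rightarrow> 'v poly fls"
  where "deformed f = (\<lambda>a b. fls_map (\<lambda>v. [:v:]) (Y a b) + fls_map (\<lambda>v. [:0, v:]) (f a b))"

definition first_order_deformations :: "('v \<Rightarrow> 'v \<Rightarrow> 'v poly fls) set"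
  where "first_order_deformations = {P.
    (\<exists>f. bilinear_fls scale f \<and> P = deformed f) \<and>
    (\<forall>a. P vac a = fls_const [:a:]) \<and>
    (\<forall>a. P a vac = fls_exp scale_t d_t (fls_const [:a:])) \<and>
    (\<forall>a b. P (d a) b = fls_ddz scale_t (P a b)) \<and>
    (\<forall>a b. fls_map d_t (P a b) = P (d a) b + P a (d b)) \<and>
    (\<forall>a b. P a b = fls_exp scale_t d_t (fls_reflect (P b a))) \<and>
    (\<forall>a b c. \<exists>l. \<forall>p q. cong_t2
      (binomial_mult scale_t l (iter_left (t_extend2 P) (t_extend2 P) [:a:] [:b:] [:c:]) p q)
      (binomial_mult scale_t l
        (iter_right scale_t (t_extend2 P) (t_extend2 P) [:a:] [:b:] [:c:]) p q))}"

text \<open>The polynomial \<open>[:a, g a:]\<close> is \<open>\<phi>\<^sub>t(a) = a + t g(a)\<close>.\<close>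

definition deformation_equiv ::
    "(('v \<Rightarrow> 'v \<Rightarrow> 'v poly fls) \<times> ('v \<Rightarrow> 'v \<Rightarrow> 'v poly fls)) set"
  where "deformation_equiv = {(P, Q).
    P \<in> first_order_deformations \<and> Q \<in> first_order_deformations \<and>
    (\<exists>g \<phi>. Vector_Spaces.linear scale scale g \<and> \<phi> = (\<lambda>a. [:a, g a:]) \<and>
      (\<forall>a b n. cong_t2 (t_extend \<phi> (P a b $$ n)) (t_extend2 Q (\<phi> a) (\<phi> b) $$ n)))}"

end

end

theory Submission
  imports Defs
begin

text \<open>
  Comparing coefficients of \<open>t\<close>, the axioms of a first order deformation \<open>Y + t f\<close> are the
  vertex algebra axioms for \<open>Y\<close> in degree \<open>0\<close> and the condition \<open>f \<in> Z\<^sup>2(V,V)\<close> in degree \<open>1\<close>;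
  the exponents witnessing associativity in the two degrees can be raised to a common one.
  Likewise \<open>1 + t g\<close> is an equivalence from \<open>Y + t f\<close> to \<open>Y + t f'\<close> iff \<open>f - f' = \<delta>\<^sub>1 g\<close>. Such a
  \<open>g\<close> automatically lies in \<open>C\<^sup>1(V,V)\<close>: evaluating at the vacuum, where \<open>f\<close> and \<open>f'\<close> vanish,
  gives \<open>Y(g \<one>, z) = 0\<close> and hence \<open>g \<one> = 0\<close>, and then \<open>g (e\<^sup>z\<^sup>d a) = e\<^sup>z\<^sup>d (g a)\<close>, whose linear
  term says that \<open>g\<close> commutes with \<open>d\<close>.
\<close>

section \<open>Truncated sums, supports and coefficients\<close>

lemma sum_atMost_eq_first_two:
  fixes F :: "nat \<Rightarrow> 'a::comm_monoid_add"
  assumes "\<And>i. i > n \<Longrightarrow> F i = 0" and "\<And>i. i > 1 \<Longrightarrow> F i = 0"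
  shows "(\<Sum>i\<le>n. F i) = F 0 + F 1"
proof -
  \<comment> \<open>In the applications \<open>n\<close> is the degree of a polynomial in
    \<open>t\<close>. For \<open>n = 0\<close> the index 1 lies outside the range, so it is first
    added as a zero term.\<close>
  have "(\<Sum>i\<le>n. F i) = (\<Sum>i\<le>max 1 n. F i)"
    by (rule sum.mono_neutral_left) (auto intro: assms)
  also have "\<dots> = (\<Sum>i\<in>{0,1}. F i)"
    by (rule sum.mono_neutral_right) (auto intro: assms)
  finally show ?thesis by simp
qed

lemma coeff_pCons_0_funpow:
  "coeff ((pCons 0 ^^ m) p) r = (if m \<le> r then coeff p (r - m) else 0)"
  by (induction m arbitrary: r) (auto simp: coeff_pCons split: nat.split)

lemma pCons_0_funpow_0 [simp]: "(pCons 0 ^^ m) 0 = 0"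
  by (induction m) simp_all

lemma coeff_Sum_any:
  assumes "finite {k. g k \<noteq> 0}"
  shows "coeff (Sum_any g) i = Sum_any (\<lambda>k. coeff (g k) i)"
proof -
  have "Sum_any (\<lambda>k. coeff (g k) i) = (\<Sum>k\<in>{k. g k \<noteq> 0}. coeff (g k) i)"
    by (rule Sum_any.expand_superset) (use assms in auto)
  then show ?thesis
    by (simp add: Sum_any.expand_set coeff_sum)
qed

text \<open>\<open>Q b c\<close> vanishes below its subdegree, which bounds \<open>k\<close>. Since
  \<open>Sum_any\<close> is 0 on infinite supports, this bound is what allows it to be split or to
  commute with \<open>coeff\<close>.\<close>

lemma finite_support_iter_right:
  fixes R :: "'a \<Rightarrow> 'c::zero \<Rightarrow> 'b::zero fls" and Q :: "'a \<Rightarrow> 'a \<Rightarrow> 'c fls"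
  assumes "\<And>c. s c 0 = 0" and "\<And>a. R a 0 = 0"
  shows "finite {k. s (r k) (R a (Q b c $$ (q - int k)) $$ n k) \<noteq> 0}"
proof (rule finite_subset)
  show "{k. s (r k) (R a (Q b c $$ (q - int k)) $$ n k) \<noteq> 0}
      \<subseteq> {..nat (q - fls_subdegree (Q b c))}"
  proof
    fix k assume "k \<in> {k. s (r k) (R a (Q b c $$ (q - int k)) $$ n k) \<noteq> 0}"
    then have "\<not> q - int k < fls_subdegree (Q b c)"
      by (auto simp: assms)
    then show "k \<in> {..nat (q - fls_subdegree (Q b c))}" by simp
  qed
qed simp

lemma fls_reflect_0 [simp]: "fls_reflect 0 = 0"
  by (rule fls_eqI) (simp add: fls_reflect_nth)

lemma t_extend2_const [simp]: "t_extend2 P [:a:] [:b:] = P a b"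
  by (rule fls_eqI) (simp add: t_extend2_def)

lemma t_extend2_0_right:
  assumes "\<And>a. P a 0 = 0"
  shows "t_extend2 P p 0 = 0"
  by (rule fls_eqI) (simp add: t_extend2_def assms fls_nth_sum)

lemma fls_eq_iff_coeff:
  "F = G \<longleftrightarrow> (\<forall>i n. coeff (F $$ n) i = coeff (G $$ n) i)"
  by (auto simp: fls_eq_iff poly_eq_iff)

lemma cong_t2_iff: "cong_t2 p q \<longleftrightarrow> coeff p 0 = coeff q 0 \<and> coeff p 1 = coeff q 1"
  by (auto simp: cong_t2_def less_2_cases_iff)

text \<open>Classes are compared as sets: \<open>F\<close> maps the class of \<open>x\<close> onto
  the class of \<open>F x\<close>, and taking images is injective on subsets of \<open>A\<close>.
  The map \<open>\<Psi>\<close> inverts this, so no representatives have to be chosen.\<close>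

lemma quotient_bij_betw:
  assumes F: "bij_betw F A B"
    and R: "R \<subseteq> A \<times> A" and S: "S \<subseteq> B \<times> B"
    and RS: "\<And>x y. x \<in> A \<Longrightarrow> y \<in> A \<Longrightarrow> (x, y) \<in> R \<longleftrightarrow> (F x, F y) \<in> S"
  obtains \<Psi> where "bij_betw \<Psi> (B // S) (A // R)"
    and "\<And>x. x \<in> A \<Longrightarrow> \<Psi> (S `` {F x}) = R `` {x}"
proof -
  have inj: "inj_on F A" and B: "B = F ` A"
    using F by (auto simp: bij_betw_def)
  have S_class: "S `` {F x} = F ` (R `` {x})" if "x \<in> A" for x
    using that R S RS unfolding B by fastforce
  have sub: "A // R \<subseteq> Pow A"
    using R by (auto simp: quotient_def)
  have "B // S = (`) F ` (A // R)"
    unfolding quotient_def B by (auto simp: S_class)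
  moreover have inj': "inj_on ((`) F) (A // R)"
    using inj_on_image_Pow[OF inj] sub by (rule inj_on_subset)
  ultimately have bij: "bij_betw ((`) F) (A // R) (B // S)"
    by (simp add: bij_betw_def)
  show thesis
  proof
    show "bij_betw (inv_into (A // R) ((`) F)) (B // S) (A // R)"
      using bij by (rule bij_betw_inv_into)
    show "inv_into (A // R) ((`) F) (S `` {F x}) = R `` {x}" if "x \<in> A" for x
      using that by (simp add: S_class inv_into_f_f[OF inj'] quotientI)
  qed
qed

section \<open>Powers of x + z, and coefficients of \<open>t\<close> in two-variable series\<close>

locale vector_space_char_0 = vector_space scale
  for scale :: "'k::field_char_0 \<Rightarrow> 'v::ab_group_add \<Rightarrow> 'v"
begin

text \<open>Pascal's rule: one further factor x + z contributes x, which shifts \<open>p\<close>,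
  and z, which shifts \<open>q\<close>.\<close>

lemma binomial_mult_Suc:
  "binomial_mult scale (Suc l) G p q
    = binomial_mult scale l G (p - 1) q + binomial_mult scale l G p (q - 1)"
proof -
  let ?G = "\<lambda>i. G (p - int (Suc l - i)) (q - int i)"
  have "(\<Sum>i\<le>l. scale (of_nat (l choose Suc i)) (?G (Suc i)))
      = (\<Sum>i\<le>Suc l. scale (of_nat (l choose i)) (?G i)) - ?G 0"
    by (subst sum.atMost_Suc_shift) simp
  \<comment> \<open>The top term drops out because \<open>l choose Suc l\<close> is 0.\<close>
  also have "\<dots> = (\<Sum>i\<le>l. scale (of_nat (l choose i)) (?G i)) - ?G 0"
    by simp
  finally have shift: "(\<Sum>i\<le>l. scale (of_nat (l choose Suc i)) (?G (Suc i)))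
      = (\<Sum>i\<le>l. scale (of_nat (l choose i)) (?G i)) - ?G 0" .
  have "binomial_mult scale (Suc l) G p q
      = ?G 0 + (\<Sum>i\<le>l. scale (of_nat (Suc l choose Suc i)) (?G (Suc i)))"
    unfolding binomial_mult_def by (subst sum.atMost_Suc_shift) simp
  also have "\<dots> = (\<Sum>i\<le>l. scale (of_nat (l choose i)) (?G i))
      + (\<Sum>i\<le>l. scale (of_nat (l choose i)) (?G (Suc i)))"
    by (simp only: binomial_Suc_Suc of_nat_add scale_left_distrib sum.distrib shift) simp
  also have "(\<Sum>i\<le>l. scale (of_nat (l choose i)) (?G i)) = binomial_mult scale l G (p - 1) q"
    unfolding binomial_mult_def by (rule sum.cong) (auto simp: Suc_diff_le algebra_simps)
  also have "(\<Sum>i\<le>l. scale (of_nat (l choose i)) (?G (Suc i))) = binomial_mult scale l G p (q - 1)"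
    unfolding binomial_mult_def by (rule sum.cong) (auto simp: algebra_simps)
  finally show ?thesis .
qed

text \<open>By Pascal's rule the series for one exponent determines the series for the next. Thus
  associativity conditions with different exponents can be brought to their maximum.\<close>

lemma binomial_mult_eq_mono:
  assumes "l \<le> m" and "binomial_mult scale l G = binomial_mult scale l H"
  shows "binomial_mult scale m G = binomial_mult scale m H"
  using assms(1)
proof (induction rule: dec_induct)
  case (step n)
  then show ?case
    by (auto simp: fun_eq_iff binomial_mult_Suc)
qed (rule assms)

lemma coeff_map_poly_scale [simp]: "coeff (map_poly (scale c) p) i = scale c (coeff p i)"
  by (simp add: coeff_map_poly)

lemma coeff_binomial_mult:
  "coeff (binomial_mult (\<lambda>c. map_poly (scale c)) l G p q) i
    = binomial_mult scale l (\<lambda>p q. coeff (G p q) i) p q"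
  by (simp add: binomial_mult_def coeff_sum)

lemma coeff_iter_right:
  assumes "\<And>a. P a 0 = 0"
  shows "coeff (iter_right (\<lambda>c. map_poly (scale c)) P Q a b c p q) i
    = Sum_any (\<lambda>k. scale (of_int (p + int k) gchoose k)
        (coeff (P a (Q b c $$ (q - int k)) $$ (p + int k)) i))"
  unfolding iter_right_def
  by (subst coeff_Sum_any, rule finite_support_iter_right) (simp_all add: assms)

lemma bilinear_fls_zero:
  assumes "bilinear_fls scale P"
  shows "P 0 b = 0" and "P a 0 = 0"
proof -
  have "P 0 b $$ n = 0" for n
    using module_hom.zero[OF module_hom_linearI, of scale scale "\<lambda>a. P a b $$ n"] assms
    by (simp add: bilinear_fls_def)
  then show "P 0 b = 0"
    by (simp add: fls_eq_iff)
  have "P a 0 $$ n = 0" for n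
    using module_hom.zero[OF module_hom_linearI, of scale scale "\<lambda>b. P a b $$ n"] assms
    by (simp add: bilinear_fls_def)
  then show "P a 0 = 0"
    by (simp add: fls_eq_iff)
qed

end

sublocale vertex_algebra \<subseteq> vector_space_char_0 ..

section \<open>The exponential of d, coefficient by coefficient\<close>

context vertex_algebra
begin

lemma d_0 [simp]: "d 0 = 0"
  using linear_d by (rule module_hom.zero[OF module_hom_linearI])

lemma d_funpow_0 [simp]: "(d ^^ k) 0 = 0"
  by (induction k) simp_all

lemmas Y_zero [simp] = bilinear_fls_zero[OF bilinear_Y]

lemma coeff_d_t [simp]: "coeff (d_t p) i = d (coeff p i)"
  by (simp add: coeff_map_poly)

lemma coeff_d_t_funpow: "coeff ((d_t ^^ k) p) i = (d ^^ k) (coeff p i)"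
  by (induction k arbitrary: p) simp_all

lemma fls_exp_0 [simp]: "fls_exp scale d 0 = 0"
  by (rule fls_eqI) (simp add: fls_exp_nth)

lemma coeff_fls_exp:
  "coeff (fls_exp scale_t d_t F $$ n) i = fls_exp scale d (fls_map (\<lambda>p. coeff p i) F) $$ n"
proof -
  have "finite {k. scale_t (inverse (fact k)) ((d_t ^^ k) (F $$ (n - int k))) \<noteq> 0}"
    by (rule fls_exp_finite) simp_all
  then show ?thesis
    by (simp add: fls_exp_nth coeff_Sum_any coeff_d_t_funpow)
qed

lemma fls_exp_const_nth: "fls_exp scale d (fls_const a) $$ int m = scale (inverse (fact m)) ((d ^^ m) a)"
proof -
  let ?e = "\<lambda>k. scale (inverse (fact k)) ((d ^^ k) (fls_const a $$ (int m - int k)))"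
  have "fls_exp scale d (fls_const a) $$ int m = Sum_any ?e"
    by (rule fls_exp_nth) simp_all
  \<comment> \<open>\<open>fls_const a\<close> is concentrated in degree 0, so only
    \<open>k = m\<close> contributes.\<close>
  also have "?e = (\<lambda>k. if k = m then scale (inverse (fact m)) ((d ^^ m) a) else 0)"
    by auto
  finally show ?thesis by simp
qed

section \<open>The linear axioms, compared by powers of \<open>t\<close>\<close>

lemma coeff_deformed:
  "coeff (deformed f a b $$ n) i
    = (if i = 0 then Y a b else if i = 1 then f a b else 0) $$ n"
  by (auto simp: deformed_def coeff_pCons split: nat.split)

lemma deformed_inject [simp]: "deformed f = deformed f' \<longleftrightarrow> f = f'"
proof
  assume "deformed f = deformed f'"
  then have "coeff (deformed f a b $$ n) 1 = coeff (deformed f' a b $$ n) 1" for a b n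
    by simp
  then show "f = f'"
    by (auto simp: coeff_deformed fun_eq_iff fls_eq_iff)
qed simp

text \<open>Splits an axiom for the deformed product into the axiom for \<open>Y\<close>, the
  condition on \<open>f\<close>, and the absence of higher powers of \<open>t\<close>, which the
  type \<open>poly\<close> would admit.\<close>

lemma deformed_eq_iff:
  "deformed f a b = F \<longleftrightarrow> fls_map (\<lambda>p. coeff p 0) F = Y a b \<and> fls_map (\<lambda>p. coeff p 1) F = f a b
    \<and> (\<forall>i>1. fls_map (\<lambda>p. coeff p i) F = 0)"
proof -
  have "deformed f a b = F \<longleftrightarrow>
      (\<forall>i. fls_map (\<lambda>p. coeff p i) F = (if i = 0 then Y a b else if i = 1 then f a b else 0))"
    by (auto simp: fls_eq_iff_coeff coeff_deformed fls_eq_iff)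
  also have "\<dots> \<longleftrightarrow> fls_map (\<lambda>p. coeff p 0) F = Y a b \<and> fls_map (\<lambda>p. coeff p 1) F = f a b
      \<and> (\<forall>i>1. fls_map (\<lambda>p. coeff p i) F = 0)"
    by (metis One_nat_def less_one linorder_neqE_nat not_less_zero zero_neq_one)
  finally show ?thesis .
qed

lemma deformed_vac_left_iff: "deformed f vac a = fls_const [:a:] \<longleftrightarrow> f vac a = 0"
proof -
  have "fls_map (\<lambda>p. coeff p i) (fls_const [:a:]) = (if i = 0 then fls_const a else 0)" for i
    by (rule fls_eqI) (simp add: coeff_pCons split: nat.split)
  then show ?thesis
    by (auto simp: deformed_eq_iff unit_left)
qed

lemma deformed_vac_right_iff:
  "deformed f a vac = fls_exp scale_t d_t (fls_const [:a:]) \<longleftrightarrow> f a vac = 0"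
proof -
  have c: "fls_map (\<lambda>p. coeff p i) (fls_const [:a:]) = (if i = 0 then fls_const a else 0)" for i
    by (rule fls_eqI) (simp add: coeff_pCons split: nat.split)
  have "fls_map (\<lambda>p. coeff p i) (fls_exp scale_t d_t (fls_const [:a:]))
      = (if i = 0 then Y a vac else 0)" for i
    by (rule fls_eqI) (simp add: coeff_fls_exp unit_right c)
  then show ?thesis
    by (auto simp: deformed_eq_iff)
qed

lemma deformed_translation_iff:
  "deformed f (d a) b = fls_ddz scale_t (deformed f a b) \<longleftrightarrow> fls_ddz scale (f a b) = f (d a) b"
proof -
  have "fls_map (\<lambda>p. coeff p i) (fls_ddz scale_t (deformed f a b))
      = (if i = 0 then Y (d a) b else if i = 1 then fls_ddz scale (f a b) else 0)" for i
    by (rule fls_eqI) (simp add: fls_ddz_nth coeff_deformed translation)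
  then show ?thesis
    by (auto simp: deformed_eq_iff)
qed

lemma deformed_derivation_iff:
  "fls_map d_t (deformed f a b) = deformed f (d a) b + deformed f a (d b)
    \<longleftrightarrow> fls_map d (f a b) = f (d a) b + f a (d b)"
proof -
  have "d (Y a b $$ n) = Y (d a) b $$ n + Y a (d b) $$ n" for n
    using arg_cong[OF derivation, of "\<lambda>F. F $$ n" a b] by simp
  then show ?thesis
    by (auto simp: fls_eq_iff_coeff coeff_deformed fls_eq_iff)
qed

lemma deformed_commutativity_iff:
  "deformed f a b = fls_exp scale_t d_t (fls_reflect (deformed f b a))
    \<longleftrightarrow> f a b = fls_exp scale d (fls_reflect (f b a))"
proof -
  have c: "fls_map (\<lambda>p. coeff p i) (fls_reflect (deformed f b a))
      = fls_reflect (if i = 0 then Y b a else if i = 1 then f b a else 0)" for i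
    by (rule fls_eqI) (simp add: fls_reflect_nth coeff_deformed)
  have "fls_map (\<lambda>p. coeff p i) (fls_exp scale_t d_t (fls_reflect (deformed f b a)))
      = (if i = 0 then Y a b else if i = 1 then fls_exp scale d (fls_reflect (f b a)) else 0)" for i
    by (rule fls_eqI) (simp add: coeff_fls_exp c commutativity[of a b])
  then show ?thesis
    by (auto simp: deformed_eq_iff)
qed

section \<open>Iterated products to first order, and associativity\<close>

lemma coeff_t_extend2_deformed:
  assumes "bilinear_fls scale f"
  shows "coeff (t_extend2 (deformed f) p q $$ n) 0 = Y (coeff p 0) (coeff q 0) $$ n" (is ?T0)
    and "coeff (t_extend2 (deformed f) p q $$ n) 1
      = f (coeff p 0) (coeff q 0) $$ n + Y (coeff p 1) (coeff q 0) $$ n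
        + Y (coeff p 0) (coeff q 1) $$ n" (is ?T1)
proof -
  \<comment> \<open>\<open>X r i j\<close> is what the \<open>t\<close>-coefficients of index
    \<open>i\<close> in \<open>p\<close> and \<open>j\<close> in \<open>q\<close> contribute to the
    coefficient of index \<open>r\<close>. For \<open>r \<le> 1\<close> no index above 1
    contributes; an index beyond a degree gives a zero argument, on which both \<open>Y\<close> and
    \<open>f\<close> vanish.\<close>
  define X where "X r i j = (if i + j \<le> r
    then coeff (deformed f (coeff p i) (coeff q j) $$ n) (r - (i + j)) else 0)" for r i j
  note f0 = bilinear_fls_zero[OF assms]
  have main: "coeff (t_extend2 (deformed f) p q $$ n) r = X r 0 0 + X r 0 1 + (X r 1 0 + X r 1 1)"
    if "r \<le> 1" for r
  proof -
    have "coeff (t_extend2 (deformed f) p q $$ n) r = (\<Sum>i\<le>degree p. \<Sum>j\<le>degree q. X r i j)"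
      by (simp add: t_extend2_def fls_nth_sum coeff_sum coeff_pCons_0_funpow X_def)
    also have "\<dots> = (\<Sum>j\<le>degree q. X r 0 j) + (\<Sum>j\<le>degree q. X r 1 j)"
      by (rule sum_atMost_eq_first_two)
        (use that in \<open>auto simp: X_def coeff_eq_0 coeff_deformed f0 intro!: sum.neutral\<close>)
    also have "(\<Sum>j\<le>degree q. X r 0 j) = X r 0 0 + X r 0 1"
      by (rule sum_atMost_eq_first_two)
        (use that in \<open>auto simp: X_def coeff_eq_0 coeff_deformed f0\<close>)
    also have "(\<Sum>j\<le>degree q. X r 1 j) = X r 1 0 + X r 1 1"
      by (rule sum_atMost_eq_first_two)
        (use that in \<open>auto simp: X_def coeff_eq_0 coeff_deformed f0\<close>)
    finally show ?thesis .
  qed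
  show ?T0 ?T1
    by (simp_all add: main X_def coeff_deformed algebra_simps)
qed

text \<open>In first order \<open>t\<close> comes from the outer or from the inner product, which
  gives the two terms on the left of the cocycle condition; \<open>[:c:]\<close> itself contributes
  no \<open>t\<close>.\<close>

lemma coeff_iter_left_deformed:
  assumes "bilinear_fls scale f"
  defines "P \<equiv> t_extend2 (deformed f)"
  shows "coeff (iter_left P P [:a:] [:b:] [:c:] p q) 0 = iter_left Y Y a b c p q"
    and "coeff (iter_left P P [:a:] [:b:] [:c:] p q) 1
      = iter_left Y f a b c p q + iter_left f Y a b c p q"
  by (simp_all add: P_def iter_left_def coeff_t_extend2_deformed[OF assms(1), simplified]
      coeff_deformed)

lemma coeff_iter_right_deformed:
  assumes f: "bilinear_fls scale f"
  defines "P \<equiv> t_extend2 (deformed f)"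
  shows "coeff (iter_right scale_t P P [:a:] [:b:] [:c:] p q) 0 = iter_right scale Y Y a b c p q"
    and "coeff (iter_right scale_t P P [:a:] [:b:] [:c:] p q) 1
      = iter_right scale Y f a b c p q + iter_right scale f Y a b c p q"
proof -
  note f0 = bilinear_fls_zero[OF f]
  have "deformed f a 0 = 0" for a
    by (simp add: fls_eq_iff_coeff coeff_deformed f0)
  then have P0: "P a 0 = 0" for a
    unfolding P_def by (rule t_extend2_0_right)
  show "coeff (iter_right scale_t P P [:a:] [:b:] [:c:] p q) 0 = iter_right scale Y Y a b c p q"
    by (simp add: coeff_iter_right[of P, OF P0])
      (simp add: P_def coeff_t_extend2_deformed[OF f, simplified] coeff_deformed iter_right_def)
  show "coeff (iter_right scale_t P P [:a:] [:b:] [:c:] p q) 1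
      = iter_right scale Y f a b c p q + iter_right scale f Y a b c p q"
    unfolding coeff_iter_right[of P, OF P0]
    unfolding iter_right_def P_def
      coeff_t_extend2_deformed[OF f] coeff_deformed
    \<comment> \<open>Both sums have finite support, so they may be merged and compared term by
      term.\<close>
    by (subst Sum_any.distrib[symmetric])
      (auto intro!: finite_support_iter_right Sum_any.cong simp: f0 scale_right_distrib add.commute)
qed

lemma deformed_associativity_iff:
  assumes f: "bilinear_fls scale f"
  defines "P \<equiv> t_extend2 (deformed f)"
  shows "(\<exists>l. \<forall>p q. cong_t2 (binomial_mult scale_t l (iter_left P P [:a:] [:b:] [:c:]) p q)
        (binomial_mult scale_t l (iter_right scale_t P P [:a:] [:b:] [:c:]) p q))
    \<longleftrightarrow> (\<exists>n. binomial_mult scale n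
        (\<lambda>p q. iter_left Y f a b c p q + iter_left f Y a b c p q)
      = binomial_mult scale n
        (\<lambda>p q. iter_right scale Y f a b c p q + iter_right scale f Y a b c p q))"
    (is "(\<exists>l. \<forall>p q. ?cong l p q) \<longleftrightarrow> (\<exists>n. ?cocycle n)")
proof -
  let ?assoc = "\<lambda>l. binomial_mult scale l (iter_left Y Y a b c)
      = binomial_mult scale l (iter_right scale Y Y a b c)"
  \<comment> \<open>For a fixed exponent the congruence is exactly the pair of its coefficients at
    \<open>t\<close>-degrees 0 and 1, so one \<open>l\<close> has to serve both.\<close>
  have "(\<forall>p q. ?cong l p q) \<longleftrightarrow> ?assoc l \<and> ?cocycle l" for l
    unfolding cong_t2_iff coeff_binomial_mult P_def
      coeff_iter_left_deformed[OF f] coeff_iter_right_deformed[OF f]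
    by (auto simp: fun_eq_iff)
  moreover have "\<exists>l. ?assoc l \<and> ?cocycle l" if "?cocycle n" for n
  proof -
    obtain m where "?assoc m" using associativity by blast
    then have "?assoc (max m n)" by (rule binomial_mult_eq_mono[rotated]) simp
    moreover have "?cocycle (max m n)"
      using that by (rule binomial_mult_eq_mono[rotated]) simp
    ultimately show ?thesis by blast
  qed
  ultimately show ?thesis by blast
qed

section \<open>Deformations and cocycles\<close>

lemma deformed_in_first_order_deformations_iff:
  "deformed f \<in> first_order_deformations \<longleftrightarrow> f \<in> Z2"
proof (cases "bilinear_fls scale f")
  case True
  then show ?thesis
    by (auto simp: first_order_deformations_def Z2_def C2_def deformed_vac_left_iff
        deformed_vac_right_iff deformed_translation_iff deformed_derivation_iff
        deformed_commutativity_iff[symmetric] deformed_associativity_iff)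
next
  case False
  \<comment> \<open>Both sides fail: as \<open>deformed\<close> is injective, no bilinear map yields
    the same product.\<close>
  then show ?thesis
    by (auto simp: first_order_deformations_def Z2_def C2_def)
qed

lemma bij_betw_deformed: "bij_betw deformed Z2 first_order_deformations"
proof -
  have "P \<in> deformed ` Z2" if P: "P \<in> first_order_deformations" for P
  proof -
    obtain f where "P = deformed f"
      using P by (auto simp: first_order_deformations_def)
    with P show ?thesis
      by (auto simp: deformed_in_first_order_deformations_iff)
  qed
  then show ?thesis
    by (auto simp: bij_betw_def inj_on_def deformed_in_first_order_deformations_iff)
qed

section \<open>Equivalences and coboundaries\<close>

lemma coeff_t_extend_deformed:
  assumes "g 0 = 0"
  defines "\<phi> \<equiv> \<lambda>a. [:a, g a:]"
  shows "coeff (t_extend \<phi> (deformed f a b $$ n)) 0 = Y a b $$ n"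
    and "coeff (t_extend \<phi> (deformed f a b $$ n)) 1 = f a b $$ n + g (Y a b $$ n)"
proof -
  let ?p = "deformed f a b $$ n"
  have "coeff (t_extend \<phi> ?p) r = coeff ((pCons 0 ^^ 0) (\<phi> (coeff ?p 0))) r
      + coeff ((pCons 0 ^^ 1) (\<phi> (coeff ?p 1))) r" for r
    unfolding t_extend_def coeff_sum
  proof (rule sum_atMost_eq_first_two)
    show "coeff ((pCons 0 ^^ i) (\<phi> (coeff ?p i))) r = 0" if "i > degree ?p" for i
      \<comment> \<open>Beyond the degree the coefficient is 0, and \<open>\<phi>\<close> maps 0 to
        0 because \<open>g 0 = 0\<close>.\<close>
      using that by (simp add: coeff_eq_0 \<phi>_def assms)
    show "coeff ((pCons 0 ^^ i) (\<phi> (coeff ?p i))) r = 0" if "i > 1" for i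
      using that by (simp add: coeff_deformed \<phi>_def assms)
  qed
  then show "coeff (t_extend \<phi> ?p) 0 = Y a b $$ n"
    and "coeff (t_extend \<phi> ?p) 1 = f a b $$ n + g (Y a b $$ n)"
    by (simp_all add: coeff_deformed \<phi>_def)
qed

lemma Z2D:
  assumes "f \<in> Z2"
  shows "bilinear_fls scale f" and "f a vac = 0" and "f vac b = 0"
  using assms unfolding Z2_def C2_def by blast+

lemma coboundary_imp_C1:
  assumes g: "Vector_Spaces.linear scale scale g"
    and vac_left: "\<And>b. \<delta>1 g vac b = 0" and vac_right: "\<And>a. \<delta>1 g a vac = 0"
  shows "g \<in> C1"
proof -
  have g0: "g 0 = 0"
    using g by (rule module_hom.zero[OF module_hom_linearI])
  have Y_vac_0: "Y a vac $$ 0 = a" and Y_vac_1: "Y a vac $$ 1 = d a" for a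
    using fls_exp_const_nth[of a 0] fls_exp_const_nth[of a 1] by (simp_all add: unit_right)
  \<comment> \<open>In degree 0 the three terms are \<open>g vac\<close>, \<open>- g vac\<close> and
    \<open>g vac\<close>.\<close>
  have "\<delta>1 g vac vac $$ 0 = 0"
    by (simp add: vac_left)
  then have vac: "g vac = 0"
    by (simp add: \<delta>1_def g0 unit_left Y_vac_0)
  \<comment> \<open>Now \<open>Y a (g vac) = 0\<close>, and in degree 1 the other two terms are
    \<open>- g (d a)\<close> and \<open>d (g a)\<close>.\<close>
  have "\<delta>1 g a vac $$ 1 = 0" for a
    by (simp add: vac_right)
  then have "g (d a) = d (g a)" for a
    by (simp add: \<delta>1_def g0 vac Y_vac_1)
  with g vac show ?thesis
    by (simp add: C1_def)
qed

lemma deformation_equiv_deformed_iff: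
  assumes f: "f \<in> Z2" and f': "f' \<in> Z2"
  shows "(deformed f, deformed f') \<in> deformation_equiv \<longleftrightarrow> (f, f') \<in> cohomologous"
proof -
  have *: "(\<forall>a b n. cong_t2 (t_extend (\<lambda>a. [:a, g a:]) (deformed f a b $$ n))
        (t_extend2 (deformed f') [:a, g a:] [:b, g b:] $$ n))
      \<longleftrightarrow> (\<lambda>a b. f a b - f' a b) = \<delta>1 g"
    if "Vector_Spaces.linear scale scale g" for g
  proof -
    have g0: "g 0 = 0"
      using that by (rule module_hom.zero[OF module_hom_linearI])
    \<comment> \<open>In degree 0 both sides are \<open>Y a b\<close>. In degree 1, \<open>u\<close>
      is the coefficient of \<open>g\<close> applied to \<open>Y a b\<close>, while \<open>v\<close>
      and \<open>w\<close> come from \<open>Y (g a) b\<close> and \<open>Y a (g b)\<close>; the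
      rearrangement produces \<open>\<delta>1 g\<close>.\<close>
    have eq: "x + u = x' + v + w \<longleftrightarrow> x - x' = w - u + v" for x x' u v w :: 'v
      by (auto simp: algebra_simps)
    show ?thesis
      unfolding cong_t2_iff coeff_t_extend_deformed[of g, OF g0] coeff_t_extend2_deformed[OF Z2D(1)[OF f']] eq
      by (simp add: \<delta>1_def fun_eq_iff fls_eq_iff g0)
  qed
  have C1: "g \<in> C1" if g: "Vector_Spaces.linear scale scale g"
    and eq: "(\<lambda>a b. f a b - f' a b) = \<delta>1 g" for g
  proof (rule coboundary_imp_C1[OF g])
    show "\<delta>1 g vac b = 0" and "\<delta>1 g a vac = 0" for a b
      by (simp_all add: eq[symmetric] Z2D[OF f] Z2D[OF f'])
  qed
  have "(deformed f, deformed f') \<in> deformation_equiv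
      \<longleftrightarrow> (\<exists>g. Vector_Spaces.linear scale scale g \<and> (\<lambda>a b. f a b - f' a b) = \<delta>1 g)"
    using f f' * by (simp add: deformation_equiv_def deformed_in_first_order_deformations_iff
        cong: conj_cong)
  \<comment> \<open>Both cocycles vanish at the vacuum, hence so does \<open>\<delta>1 g\<close>,
    and this places \<open>g\<close> in \<open>C1\<close>.\<close>
  also have "\<dots> \<longleftrightarrow> (\<exists>g \<in> C1. (\<lambda>a b. f a b - f' a b) = \<delta>1 g)"
    using C1 unfolding C1_def by blast
  also have "\<dots> \<longleftrightarrow> (f, f') \<in> cohomologous"
    using f f' by (auto simp: cohomologous_def)
  finally show ?thesis .
qed

end

theorem theorem5p2:
  fixes scale :: "'k::{alg_closed_field, field_char_0} \<Rightarrow> 'v::ab_group_add \<Rightarrow> 'v"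
    and Y :: "'v \<Rightarrow> 'v \<Rightarrow> 'v fls" and vac :: 'v and d :: "'v \<Rightarrow> 'v"
  assumes "vertex_algebra scale Y vac d"
  shows "\<exists>\<Psi>. bij_betw \<Psi>
      (vertex_algebra.first_order_deformations scale Y vac d
        // vertex_algebra.deformation_equiv scale Y vac d)
      (vertex_algebra.H2 scale Y vac d) \<and>
    (\<forall>f. vertex_algebra.deformed Y f \<in> vertex_algebra.first_order_deformations scale Y vac d \<longrightarrow>
      \<Psi> (vertex_algebra.deformation_equiv scale Y vac d `` {vertex_algebra.deformed Y f})
        = vertex_algebra.cohomologous scale Y vac d `` {f})"
proof -
  interpret vertex_algebra scale Y vac d by fact
  have "cohomologous \<subseteq> Z2 \<times> Z2"
    and "deformation_equiv \<subseteq> first_order_deformations \<times> first_order_deformations"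
    by (auto simp: cohomologous_def deformation_equiv_def)
  \<comment> \<open>The bijection \<open>deformed\<close> from \<open>Z2\<close> matches
    \<open>cohomologous\<close> with \<open>deformation_equiv\<close>; \<open>\<Psi>\<close> inverts
    the map it induces on classes.\<close>
  then obtain \<Psi> where
      "bij_betw \<Psi> (first_order_deformations // deformation_equiv) (Z2 // cohomologous)"
    and "\<And>f. f \<in> Z2 \<Longrightarrow> \<Psi> (deformation_equiv `` {deformed f}) = cohomologous `` {f}"
    using deformation_equiv_deformed_iff[symmetric]
    by (rule quotient_bij_betw[OF bij_betw_deformed]) (assumption, assumption, rule that)
  then show ?thesis
    by (auto simp: H2_def deformed_in_first_order_deformations_iff)
qed

end
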